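(* Let $\mathbb{F}$ be an algebraically closed field of characteristic not $2$, and let $i\in\mathbb{F}$ satisfy $i^2=-1$. The automorphism groups of the $2$-dimensional evolution algebras $E_1(b,c)$ ($b,c\in\mathbb{F}$, $bc\ne1$), $E_2(b)$ ($b\in\mathbb{F}$), $E_3$, $E_4$, $E_5$, $E_6$ over $\mathbb{F}$ are as follows, where $I$ is the $2\times2$ identity matrix: \begin{itemize} \item $Aut(E_1(b,c))=\{I\}$ if $b\neq c$; \item $Aut(E_1(b,b))=\left\{I,\begin{pmatrix}0&1\\1&0\end{pmatrix}\right\}$ if $b^2\neq 1$; \item $Aut(E_2(b))=\{I\}$ if $b\neq 0$; \item $Aut(E_2(0))=\left\{\begin{pmatrix}1&0\\t&1-t\end{pmatrix}: t\in\mathbb{F},\ t\neq 1\right\}$; \item $Aut(E_3)=\left\{I,\begin{pmatrix}0&1\\1&0\end{pmatrix},\begin{pmatrix}t&0\\0&t^2\end{pmatrix},\begin{pmatrix}t^2&0\\0&t\end{pmatrix},\begin{pmatrix}0&t\\t^2&0\end{pmatrix},\begin{pmatrix}0&t^2\\t&0\end{pmatrix}\right\}$, where $t=-\frac12+i\frac{\sqrt3}{2}$; \item $Aut(E_4)=\left\{I,\begin{pmatrix}1&0\\0&-1\end{pmatrix}\right\}$; \item $Aut(E_5)=\left\{\begin{pmatrix}t&1-t\\1-t&t\end{pmatrix}: t\in\mathbb{F},\ t\neq\frac12\right\}$; \item $Aut(E_6)=\left\{\begin{pmatrix}t^2&s\\0&t\end{pmatrix}: t,s\in\mathbb{F},\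 t\neq0\right\}$. \end{itemize}
   Context: A $2$-dimensional algebra over $\mathbb{F}$ with basis $(e_1,e_2)$ and $e_i\cdot e_j=A^1_{i,j}e_1+A^2_{i,j}e_2$ is identified with its matrix of structure constants $$A=\begin{pmatrix} A^1_{1,1}&A^1_{1,2}&A^1_{2,1}&A^1_{2,2}\\ A^2_{1,1}&A^2_{1,2}&A^2_{2,1}&A^2_{2,2}\end{pmatrix},$$ so that in coordinate column vectors the product of $u$ and $v$ is $A(u\otimes v)$ (Kronecker product). The algebras considered (up to isomorphism, all the nontrivial $2$-dimensional evolution algebras over $\mathbb{F}$, i.e. algebras with nonzero multiplication having a basis with $e_1e_2=e_2e_1=0$) are $$E_{1}(b,c)=\begin{pmatrix} 1 & 0 & 0 & b\\ c & 0 & 0 & 1\end{pmatrix}\ (bc\neq1),\quad E_{2}(b)=\begin{pmatrix} 1 & 0 & 0 & b\\ 1 & 0 & 0 & 0\end{pmatrix},\quad E_{3}=\begin{pmatrix} 0 & 0 & 0 & 1\\ 1 & 0 & 0 & 0\end{pmatrix},$$ $$E_{4}=\begin{pmatrix} 1 & 0 & 0 & 1\\ 0 & 0 & 0 & 0\end{pmatrix},\quad E_5=\begin{pmatrix} 1 & 0 & 0 & -1\\ -1 & 0 & 0 & 1\end{pmatrix},\quad E_{6}=\begin{pmatrix} 0 & 0 & 0 & 1\\ 0 & 0 & 0 & 0\end{pmatrix}.$$ For an algebra with matrix of structure constants $E$, its automorphism group is $Aut(E)=\{g\in GL(2,\mathbb{F}):\ gE-E(g\otimes g)=0\}$. Here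 $\sqrt3$ denotes an element of $\mathbb{F}$ whose square is $3$. *)

theory Defs
  imports "HOL-Analysis.Analysis"
begin

definition mat2 :: "'a::zero \<Rightarrow> 'a \<Rightarrow> 'a \<Rightarrow> 'a \<Rightarrow> 'a^2^2" where
  "mat2 a b c d = vector [vector [a, b], vector [c, d]]"

(* Rows and columns are ordered by the index pairs (1,1), (1,2), (2,1), (2,2),
   the same order as the columns of a matrix of structure constants. *)
definition kronecker2 :: "'a::semiring_1^2^2 \<Rightarrow> 'a^2^2 \<Rightarrow> 'a^4^4" (infixl "\<otimes>\<^sub>K" 75) where
  "g \<otimes>\<^sub>K h = vector
    [vector [g$1$1 * h$1$1, g$1$1 * h$1$2, g$1$2 * h$1$1, g$1$2 * h$1$2],
     vector [g$1$1 * h$2$1, g$1$1 * h$2$2, g$1$2 * h$2$1, g$1$2 * h$2$2],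
     vector [g$2$1 * h$1$1, g$2$1 * h$1$2, g$2$2 * h$1$1, g$2$2 * h$1$2],
     vector [g$2$1 * h$2$1, g$2$1 * h$2$2, g$2$2 * h$2$1, g$2$2 * h$2$2]]"

(* Row k of a matrix of structure constants lists the e_k-coordinates of the products
   e_1 e_1, e_1 e_2, e_2 e_1, e_2 e_2, in this order. *)
definition Aut :: "'a::field^4^2 \<Rightarrow> ('a^2^2) set" where
  "Aut E = {g. invertible g \<and> g ** E - E ** (g \<otimes>\<^sub>K g) = 0}"

definition E1 :: "'a::field \<Rightarrow> 'a \<Rightarrow> 'a^4^2" where
  "E1 b c = vector [vector [1, 0, 0, b], vector [c, 0, 0, 1]]"

definition E2 :: "'a::field \<Rightarrow> 'a^4^2" where
  "E2 b = vector [vector [1, 0, 0, b], vector [1, 0, 0, 0]]"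

definition E3 :: "'a::field^4^2" where
  "E3 = vector [vector [0, 0, 0, 1], vector [1, 0, 0, 0]]"

definition E4 :: "'a::field^4^2" where
  "E4 = vector [vector [1, 0, 0, 1], vector [0, 0, 0, 0]]"

definition E5 :: "'a::field^4^2" where
  "E5 = vector [vector [1, 0, 0, -1], vector [-1, 0, 0, 1]]"

definition E6 :: "'a::field^4^2" where
  "E6 = vector [vector [0, 0, 0, 1], vector [0, 0, 0, 0]]"

end

theory Submission
  imports Defs
begin

text \<open>
  For an evolution algebra with \<open>e\<^sub>1 e\<^sub>1 = a e\<^sub>1 + c e\<^sub>2\<close> and
  \<open>e\<^sub>2 e\<^sub>2 = b e\<^sub>1 + d e\<^sub>2\<close>, the matrix equation defining an automorphism
  with rows \<open>(p, q)\<close> and \<open>(r, s)\<close> amounts to six quadratic equations. The two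
  coming from \<open>e\<^sub>1 e\<^sub>2 = 0\<close> say that \<open>(p q, r s)\<close> lies in the kernel of the
  matrix with rows \<open>(a, b)\<close> and \<open>(c, d)\<close>. If that matrix is regular, then
  \<open>p q = r s = 0\<close>, so an invertible solution is diagonal or antidiagonal, and the
  remaining equations in two unknowns are solved directly. The singular algebras are
  solved by elimination.
\<close>

lemma vector_4 [simp]:
  "(vector [w, x, y, z] :: 'a::zero^4)$1 = w"
  "(vector [w, x, y, z] :: 'a::zero^4)$2 = x"
  "(vector [w, x, y, z] :: 'a::zero^4)$3 = y"
  "(vector [w, x, y, z] :: 'a::zero^4)$4 = z"
  unfolding vector_def by simp_all

lemma mat2_exhaust:
  obtains p q r s where "g = mat2 p q r s"
proof
  show "g = mat2 (g$1$1) (g$1$2) (g$2$1) (g$2$2)"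
    by (simp add: mat2_def vec_eq_iff forall_2)
qed

lemma mat2_eq_iff: "mat2 p q r s = mat2 p' q' r' s' \<longleftrightarrow> p = p' \<and> q = q' \<and> r = r' \<and> s = s'"
  by (auto simp: mat2_def vec_eq_iff forall_2)

lemma mat_1_eq_mat2: "mat 1 = mat2 1 0 0 1"
  by (simp add: mat2_def vec_eq_iff forall_2 mat_def)

lemma invertible_mat2_iff:
  fixes p :: "'a::field"
  shows "invertible (mat2 p q r s) \<longleftrightarrow> p * s \<noteq> q * r"
  by (simp add: invertible_det_nz det_2 mat2_def)

text \<open>Six equations suffice for the eight entries: since multiplication in the field commutes,
  the columns for \<open>e_1 e_2\<close> and \<open>e_2 e_1\<close> give the same
  conditions.\<close>

lemma mat2_in_Aut_iff:
  fixes p :: "'a::field"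
  shows "mat2 p q r s \<in> Aut (vector [vector [a, 0, 0, b], vector [c, 0, 0, d]]) \<longleftrightarrow>
    p * s \<noteq> q * r \<and>
    a * p + c * q = a * p^2 + b * r^2 \<and> a * (p * q) + b * (r * s) = 0 \<and>
    b * p + d * q = a * q^2 + b * s^2 \<and>
    a * r + c * s = c * p^2 + d * r^2 \<and> c * (p * q) + d * (r * s) = 0 \<and>
    b * r + d * s = c * q^2 + d * s^2"
  unfolding Aut_def mem_Collect_eq invertible_mat2_iff
  by (auto simp: mat2_def kronecker2_def vec_eq_iff forall_2 forall_4 matrix_matrix_mult_def
      sum_2 sum_4 power2_eq_square mult_ac)

lemmas evolution_simps =
  E1_def E2_def E3_def E4_def E5_def E6_def mat2_in_Aut_iff mat_1_eq_mat2 mat2_eq_iff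

lemma diagonal_or_antidiagonal:
  fixes p :: "'a::field"
  assumes "p * s \<noteq> q * r" and "p * q = 0" and "r * s = 0"
  shows "(q = 0 \<and> r = 0 \<and> p \<noteq> 0 \<and> s \<noteq> 0) \<or> (p = 0 \<and> s = 0 \<and> q \<noteq> 0 \<and> r \<noteq> 0)"
  using assms by auto

text \<open>Swapping the basis vectors turns \<open>E1 b c\<close> into \<open>E1 c b\<close>, so
  the swap is an automorphism exactly when \<open>b = c\<close>. Both cases are treated at once
  here.\<close>

lemma mat2_in_Aut_E1_iff:
  fixes b c :: "'a::field"
  assumes "b * c \<noteq> 1"
  shows "mat2 p q r s \<in> Aut (E1 b c) \<longleftrightarrow>
    mat2 p q r s = mat 1 \<or> b = c \<and> mat2 p q r s = mat2 0 1 1 0"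
proof
  assume "mat2 p q r s \<in> Aut (E1 b c)"
  then have ne: "p * s \<noteq> q * r"
    and eqs: "p + c * q = p^2 + b * r^2" "b * p + q = q^2 + b * s^2"
      "r + c * s = c * p^2 + r^2" "b * r + s = c * q^2 + s^2"
    and k: "p * q + b * (r * s) = 0" "c * (p * q) + r * s = 0"
    by (simp_all add: evolution_simps)
  \<comment> \<open>Cramer's rule; \<open>1 - b * c\<close> is the determinant of the system
    \<open>k\<close>.\<close>
  have "(1 - b * c) * (p * q) = 0" "(1 - b * c) * (r * s) = 0"
    using k by algebra+
  with assms have "p * q = 0" "r * s = 0"
    by auto
  from diagonal_or_antidiagonal [OF ne this]
  show "mat2 p q r s = mat 1 \<or> b = c \<and> mat2 p q r s = mat2 0 1 1 0"
  proof (elim disjE conjE)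
    assume "q = 0" "r = 0" "p \<noteq> 0" "s \<noteq> 0"
    with eqs(1,4) show ?thesis
      by (simp add: evolution_simps power2_eq_square)
  next
    assume "p = 0" "s = 0" "q \<noteq> 0" "r \<noteq> 0"
    with eqs(2,3) have "q = 1" "r = 1"
      by (simp_all add: power2_eq_square)
    with eqs(4) \<open>p = 0\<close> \<open>s = 0\<close> show ?thesis
      by (simp add: evolution_simps)
  qed
qed (auto simp: evolution_simps)

lemma Aut_E1:
  fixes b c :: "'a::field"
  assumes "b * c \<noteq> 1" and "b \<noteq> c"
  shows "Aut (E1 b c) = {mat 1}"
proof (rule set_eqI)
  fix g :: "'a^2^2"
  show "g \<in> Aut (E1 b c) \<longleftrightarrow> g \<in> {mat 1}"
    by (cases g rule: mat2_exhaust) (use assms in \<open>simp add: mat2_in_Aut_E1_iff\<close>)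
qed

lemma Aut_E1_same:
  fixes b :: "'a::field"
  assumes "b^2 \<noteq> 1"
  shows "Aut (E1 b b) = {mat 1, mat2 0 1 1 0}"
proof (rule set_eqI)
  fix g :: "'a^2^2"
  show "g \<in> Aut (E1 b b) \<longleftrightarrow> g \<in> {mat 1, mat2 0 1 1 0}"
    by (cases g rule: mat2_exhaust)
      (use assms in \<open>simp add: mat2_in_Aut_E1_iff power2_eq_square\<close>)
qed

lemma Aut_E2:
  fixes b :: "'a::field"
  assumes "b \<noteq> 0"
  shows "Aut (E2 b) = {mat 1}"
proof (rule set_eqI)
  fix g :: "'a^2^2"
  obtain p q r s where g: "g = mat2 p q r s"
    by (rule mat2_exhaust)
  show "g \<in> Aut (E2 b) \<longleftrightarrow> g \<in> {mat 1}"
  proof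
    assume "g \<in> Aut (E2 b)"
    with assms have ne: "p * s \<noteq> q * r" and k: "p * q = 0" "r * s = 0"
      and eqs: "p + q = p^2 + b * r^2" "b * p = q^2 + b * s^2" "r + s = p^2"
      by (auto simp: g evolution_simps)
    \<comment> \<open>The antidiagonal case fails because the second equation becomes
      \<open>q^2 = 0\<close>. In the diagonal case \<open>p = p^2\<close> gives
      \<open>p = 1\<close>, and then \<open>s = p^2 = 1\<close>.\<close>
    from diagonal_or_antidiagonal [OF ne k] show "g \<in> {mat 1}"
      using eqs by (auto simp: g evolution_simps power2_eq_square)
  qed (auto simp: g evolution_simps)
qed

text \<open>Now \<open>e_2\<close> spans the annihilator, which every automorphism preserves; hence
  \<open>q = 0\<close>, and then \<open>p = 1\<close> and \<open>r + s = 1\<close> with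
  \<open>r\<close> free.\<close>

lemma Aut_E2_0: "Aut (E2 (0 :: 'a::field)) = {mat2 1 0 t (1 - t) | t. t \<noteq> 1}"
proof (rule set_eqI)
  fix g :: "'a^2^2"
  obtain p q r s where g: "g = mat2 p q r s"
    by (rule mat2_exhaust)
  show "g \<in> Aut (E2 0) \<longleftrightarrow> g \<in> {mat2 1 0 t (1 - t) | t. t \<noteq> 1}"
  proof
    assume "g \<in> Aut (E2 0)"
    then have ne: "p * s \<noteq> q * r" and eqs: "p + q = p^2" "q = 0" "r + s = p^2"
      by (auto simp: g evolution_simps)
    then have "p = 1" "s = 1 - r" "r \<noteq> 1"
      by (auto simp: power2_eq_square eq_diff_eq add.commute)
    with eqs show "g \<in> {mat2 1 0 t (1 - t) | t. t \<noteq> 1}"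
      by (auto simp: g)
  qed (auto simp: g evolution_simps)
qed

text \<open>Since \<open>t + t^2 = -1\<close> and \<open>t * t^2 = 1\<close>, the polynomial
  \<open>x^2 + x + 1\<close> splits as \<open>(x - t) * (x - t^2)\<close>. The roots may
  coincide.\<close>

lemma cube_root_of_unity_cases:
  fixes x t :: "'a::field"
  assumes "t^2 + t + 1 = 0" and "x^3 = 1"
  shows "x = 1 \<or> x = t \<or> x = t^2"
proof -
  have "(x - 1) * ((x - t) * (x - t^2)) = 0"
    using assms by algebra
  then show ?thesis
    by auto
qed

text \<open>Assuming only the quadratic equation for \<open>t\<close> covers characteristic 3 as
  well, where \<open>t = 1\<close> and the six listed matrices collapse to two.\<close>

lemma Aut_E3:
  fixes t :: "'a::field"
  assumes t: "t^2 + t + 1 = 0"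
  shows "Aut (E3 :: 'a^4^2) =
    {mat 1, mat2 0 1 1 0, mat2 t 0 0 (t^2), mat2 (t^2) 0 0 t,
     mat2 0 t (t^2) 0, mat2 0 (t^2) t 0}" (is "_ = ?R")
proof (rule set_eqI)
  fix g :: "'a^2^2"
  obtain p q r s where g: "g = mat2 p q r s"
    by (rule mat2_exhaust)
  have t3: "t^3 = 1"
    using t by algebra
  have t4: "t^4 = t"
    using t by algebra
  have nz: "t \<noteq> 0"
    using t by auto
  have ne: "t * t^2 = 1" "t^2 * t = 1"
    using t3 by (simp_all add: power2_eq_square power3_eq_cube mult.assoc)
  \<comment> \<open>Substituting gives \<open>x = x^4\<close>. This serves the diagonal pair
    \<open>(p, s)\<close> and the antidiagonal pair \<open>(q, r)\<close> alike.\<close>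
  have square_pair: "(x, y) \<in> {(1, 1), (t, t^2), (t^2, t)}"
    if "x \<noteq> 0" "x = y^2" "y = x^2" for x y
  proof -
    have "x * (x^3 - 1) = 0"
      using that(2,3) by algebra
    with that(1) have "x^3 = 1"
      by simp
    from cube_root_of_unity_cases [OF t this] show ?thesis
      using that(3) t4 by auto
  qed
  show "g \<in> Aut E3 \<longleftrightarrow> g \<in> ?R"
  proof
    assume "g \<in> Aut E3"
    then have "p * s \<noteq> q * r" "p * q = 0" "r * s = 0"
      and eqs: "p = s^2" "s = p^2" "q = r^2" "r = q^2"
      unfolding g E3_def mat2_in_Aut_iff mult_1_left mult_zero_left add_0_left add_0_right
      by blast+
    from diagonal_or_antidiagonal [OF this(1-3)] show "g \<in> ?R"
    proof (elim disjE conjE)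
      assume "q = 0" "r = 0" "p \<noteq> 0"
      moreover from square_pair [OF this(3) eqs(1,2)]
      have "(p, s) \<in> {(1, 1), (t, t^2), (t^2, t)}" .
      ultimately show ?thesis
        by (auto simp: g evolution_simps)
    next
      assume "p = 0" "s = 0" "q \<noteq> 0"
      moreover from square_pair [OF this(3) eqs(3,4)]
      have "(q, r) \<in> {(1, 1), (t, t^2), (t^2, t)}" .
      ultimately show ?thesis
        by (auto simp: g evolution_simps)
    qed
  qed (auto simp: g evolution_simps t4 ne nz)
qed

text \<open>All products lie on the line of \<open>e_1\<close>, which an automorphism must preserve;
  this is the equation \<open>r = 0\<close>. Then \<open>p = p^2\<close> and
  \<open>p * q = 0\<close> with \<open>p\<close> nonzero, and \<open>s^2 = 1\<close>
  remains.\<close>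

lemma Aut_E4: "Aut (E4 :: 'a::field^4^2) = {mat 1, mat2 1 0 0 (-1)}"
proof (rule set_eqI)
  fix g :: "'a^2^2"
  obtain p q r s where g: "g = mat2 p q r s"
    by (rule mat2_exhaust)
  show "g \<in> Aut E4 \<longleftrightarrow> g \<in> {mat 1, mat2 1 0 0 (-1)}"
  proof
    assume "g \<in> Aut E4"
    then have ne: "p * s \<noteq> q * r"
      and eqs: "p = p^2 + r^2" "p * q + r * s = 0" "p = q^2 + s^2" "r = 0"
      unfolding g E4_def mat2_in_Aut_iff mult_1_left mult_zero_left add_0_right by blast+
    then have "p \<noteq> 0"
      by auto
    with eqs(1,2,4) have "p = 1" "q = 0"
      by (simp_all add: power2_eq_square)
    with eqs(3) have "s = 1 \<or> s = -1"
      by (simp add: power2_eq_1_iff [symmetric])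
    with \<open>p = 1\<close> \<open>q = 0\<close> eqs show "g \<in> {mat 1, mat2 1 0 0 (-1)}"
      by (auto simp: g evolution_simps)
  qed (auto simp: g evolution_simps)
qed

lemma Aut_E5:
  assumes two: "(2 :: 'a::field) \<noteq> 0"
  shows "Aut (E5 :: 'a^4^2) = {mat2 t (1 - t) (1 - t) t | t. t \<noteq> 1 / 2}"
proof (rule set_eqI)
  fix g :: "'a^2^2"
  obtain p q r s where g: "g = mat2 p q r s"
    by (rule mat2_exhaust)
  \<comment> \<open>The two sides differ by the determinant \<open>2 * t - 1\<close> of the listed
    matrix.\<close>
  have half: "t * t = (1 - t) * (1 - t) \<longleftrightarrow> t = 1 / 2" for t :: 'a
  proof -
    have "t * t - (1 - t) * (1 - t) = t * 2 - 1"
      by (simp add: algebra_simps)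
    then have "t * t = (1 - t) * (1 - t) \<longleftrightarrow> t * 2 = 1"
      by (simp only: eq_iff_diff_eq_0 [of "t * t"] eq_iff_diff_eq_0 [of "t * 2"])
    with two show ?thesis
      by (simp add: eq_divide_eq)
  qed
  show "g \<in> Aut E5 \<longleftrightarrow> g \<in> {mat2 t (1 - t) (1 - t) t | t. t \<noteq> 1 / 2}"
  proof
    assume "g \<in> Aut E5"
    then have ne: "p * s \<noteq> q * r"
      and eqs: "p - q = p^2 - r^2" "p * q - r * s = 0" "r - s = - (p^2) + r^2"
      unfolding g E5_def mat2_in_Aut_iff mult_1_left mult_minus1 add_uminus_conv_diff by blast+
    \<comment> \<open>All products are multiples of \<open>e_1 - e_2\<close>, so an automorphism
      preserves that line, where the coordinate sum vanishes: both columns have equal sums. A common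
      sum of zero would make the matrix singular.\<close>
    have col: "p + r = q + s"
      using eqs(1,3) by algebra
    have "p + r \<noteq> 0"
    proof
      assume "p + r = 0"
      with col have "p * s = q * r"
        by algebra
      with ne show False ..
    qed
    \<comment> \<open>Put \<open>q = p + r - s\<close> into \<open>p * q - r * s\<close>.\<close>
    moreover have "(p + r) * (p - s) = 0"
      using eqs(2) col by algebra
    ultimately have s: "s = p"
      by simp
    with col have r: "r = q"
      by simp
    have "(p - q) * (p + q - 1) = 0"
      using eqs(1) r by algebra
    with ne r s have "p + q = 1"
      by auto
    then have q: "q = 1 - p"
      by algebra
    with ne r s half have "p \<noteq> 1 / 2"
      by auto
    with q r s show "g \<in> {mat2 t (1 - t) (1 - t) t | t. t \<noteq> 1 / 2}"
      by (auto simp: g)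
  next
    assume "g \<in> {mat2 t (1 - t) (1 - t) t | t. t \<noteq> 1 / 2}"
    then have "p \<noteq> 1 / 2" and eqs: "q = 1 - p" "r = 1 - p" "s = p"
      by (auto simp: g evolution_simps)
    with half have "p * s \<noteq> q * r"
      by simp
    then show "g \<in> Aut E5"
      unfolding g eqs by (simp add: evolution_simps power2_eq_square algebra_simps)
  qed
qed

lemma Aut_E6: "Aut (E6 :: 'a::field^4^2) = {mat2 (t^2) s 0 t | t s. t \<noteq> 0}"
proof (rule set_eqI)
  fix g :: "'a^2^2"
  obtain p q r s where g: "g = mat2 p q r s"
    by (rule mat2_exhaust)
  show "g \<in> Aut E6 \<longleftrightarrow> g \<in> {mat2 (t^2) s 0 t | t s. t \<noteq> 0}"
    by (auto simp: g evolution_simps)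
qed

theorem theorem3p1:
  fixes i sqrt3 :: "'a::alg_closed_field"
  assumes "CHAR('a) \<noteq> 2"
    and "i^2 = -1"
    and "sqrt3^2 = 3"
  shows
    "(\<forall>b c :: 'a. b * c \<noteq> 1 \<longrightarrow> b \<noteq> c \<longrightarrow> Aut (E1 b c) = {mat 1}) \<and>
     (\<forall>b :: 'a. b^2 \<noteq> 1 \<longrightarrow> Aut (E1 b b) = {mat 1, mat2 0 1 1 0}) \<and>
     (\<forall>b :: 'a. b \<noteq> 0 \<longrightarrow> Aut (E2 b) = {mat 1}) \<and>
     Aut (E2 (0 :: 'a)) = {mat2 1 0 t (1 - t) | t. t \<noteq> 1} \<and>
     (let t = - (1 / 2) + i * (sqrt3 / 2) in
       Aut (E3 :: 'a^4^2) =
         {mat 1, mat2 0 1 1 0, mat2 t 0 0 (t^2), mat2 (t^2) 0 0 t,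
          mat2 0 t (t^2) 0, mat2 0 (t^2) t 0}) \<and>
     Aut (E4 :: 'a^4^2) = {mat 1, mat2 1 0 0 (-1)} \<and>
     Aut (E5 :: 'a^4^2) = {mat2 t (1 - t) (1 - t) t | t. t \<noteq> 1 / 2} \<and>
     Aut (E6 :: 'a^4^2) = {mat2 (t^2) s 0 t | t s. t \<noteq> 0}"
proof -
  have two: "(2 :: 'a) \<noteq> 0"
  proof
    assume "(2 :: 'a) = 0"
    then have "of_nat 2 = (0 :: 'a)"
      by simp
    then have "CHAR('a) dvd 2"
      by (simp only: of_nat_eq_0_iff_char_dvd)
    \<comment> \<open>A divisor of 2 is 1 or 2, and a field does not have characteristic 1.\<close>
    with assms(1) show False
      using CHAR_not_1' [where ?'a = 'a] two_is_prime_nat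
      by (auto simp: prime_nat_iff)
  qed
  define t where "t = - (1 / 2) + i * (sqrt3 / 2)"
  have "2 * t + 1 = i * sqrt3"
    using two by (simp add: t_def field_simps)
  \<comment> \<open>Complete the square: \<open>4 * (t^2 + t + 1) = (2 * t + 1)^2 + 3\<close>, and
    \<open>(i * sqrt3)^2 = -3\<close>. The factor 4 is kept as \<open>2 * 2\<close> so that
    \<open>two\<close> cancels it.\<close>
  then have "2 * 2 * (t^2 + t + 1) = 0"
    using assms(2,3) by algebra
  then have t: "t^2 + t + 1 = 0"
    using two by (simp only: mult_eq_0_iff) simp
  show ?thesis
    unfolding Let_def t_def [symmetric]
    by (intro conjI allI impI Aut_E1 Aut_E1_same Aut_E2 Aut_E2_0 Aut_E3 Aut_E4 Aut_E5 Aut_E6 t two)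
qed

end
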